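(* Let $\mathbf{s}$ be a binary sequence of even period $N$ with minimal polynomial $P_{\mathbf{s}}(x)\in\mathbb{F}_2[x]$, regarded also as an element of $\mathbb{F}_4[x]$, where $\mathbb{F}_4=\mathbb{F}_2\mu+\mathbb{F}_2$ with $\mu^2+\mu+1=0$. For binary sequences $\mathbf{s}_1,\mathbf{s}_2$ of period $N$, identify the quaternary sequence $\phi^{-1}(\mathbf{s}_1,\mathbf{s}_2)$ with the sequence over $\mathbb{F}_4$ given by $t\mapsto s_1(t)\mu+s_2(t)$. (i) If $\mathbf{u}=\phi^{-1}(\mathbf{s},L^{N/2}(\mathbf{s}))$, then $P_{\mathbf{u}}(x)=P_{\mathbf{s}}(x)$ in $\mathbb{F}_4[x]$. (ii) If $\mathbf{u}=\phi^{-1}(\mathbf{s},L^{N/2}(\overline{\mathbf{s}}))$ and $(x-1)^{2}\mid P_{\mathbf{s}}(x)$, then $P_{\mathbf{u}}(x)=P_{\mathbf{s}}(x)$ in $\mathbb{F}_4[x]$.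
   Context: For a sequence $\mathbf{v}$ of period $N$ over a finite field $\mathbb{F}_q$ with sequence polynomial $\mathbf{v}(x)=\sum_{t=0}^{N-1}v(t)x^t$, its minimal polynomial is $P_{\mathbf{v}}(x)=(x^{N}-1)/\gcd(x^{N}-1,\mathbf{v}(x))$. $L^{\tau}(\mathbf{s})=(s(t+\tau))_t$ (indices mod $N$) is the left cyclic shift, $\overline{\mathbf{s}}$ is the binary complement ($\overline{s}(t)=1-s(t)$), and $\phi$ is the Gray map $\phi(0)=(0,0),\phi(1)=(0,1),\phi(2)=(1,1),\phi(3)=(1,0)$, with $u(t)=\phi^{-1}(s_1(t),s_2(t))$. *)

theory Defs
  imports
    "HOL-Library.Z2"
    "HOL-Library.Numeral_Type"
    "HOL-Computational_Algebra.Computational_Algebra"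
    "HOL-Computational_Algebra.Field_as_Ring"
begin

section \<open>The field with two elements as a \<open>field_gcd\<close>\<close>

text \<open>
  Polynomial gcds need the coefficient field to be in class \<open>field_gcd\<close>; the instances follow
  \<open>Field_as_Ring\<close>, so that gcds of polynomials are monic (or zero).
\<close>

instantiation bit ::
  "{unique_euclidean_ring, normalization_euclidean_semiring, normalization_semidom_multiplicative}"
begin

definition [simp]: "normalize_bit = (normalize_field :: bit \<Rightarrow> _)"
definition [simp]: "unit_factor_bit = (unit_factor_field :: bit \<Rightarrow> _)"
definition [simp]: "euclidean_size_bit = (euclidean_size_field :: bit \<Rightarrow> _)"
definition [simp]: "division_segment (x :: bit) = 1"

instance
proof
  fix a b q r :: bit
  show "b \<noteq> 0 \<Longrightarrow> euclidean_size (a mod b) < euclidean_size b"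
    and "b \<noteq> 0 \<Longrightarrow> euclidean_size a \<le> euclidean_size (a * b)"
    and "euclidean_size (a * b) = euclidean_size a * euclidean_size b"
    and "unit_factor (a * b) = unit_factor a * unit_factor b"
    and "unit_factor a * normalize a = a"
    and "is_unit a \<Longrightarrow> unit_factor (a * b) = a * unit_factor b"
    by (cases a; cases b; simp)+
  show "b \<noteq> 0 \<Longrightarrow> euclidean_size r < euclidean_size b \<Longrightarrow> (q * b + r) div b = q"
    by (cases q; cases r; cases b; simp)
qed simp_all

end

instantiation bit :: euclidean_ring_gcd
begin

definition gcd_bit :: "bit \<Rightarrow> bit \<Rightarrow> bit" where
  "gcd_bit = Euclidean_Algorithm.gcd"
definition lcm_bit :: "bit \<Rightarrow> bit \<Rightarrow> bit" where
  "lcm_bit = Euclidean_Algorithm.lcm"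
definition Gcd_bit :: "bit set \<Rightarrow> bit" where
  "Gcd_bit = Euclidean_Algorithm.Gcd"
definition Lcm_bit :: "bit set \<Rightarrow> bit" where
  "Lcm_bit = Euclidean_Algorithm.Lcm"

instance by standard (simp_all add: gcd_bit_def lcm_bit_def Gcd_bit_def Lcm_bit_def)

end

instance bit :: field_gcd ..


section \<open>The field with four elements\<close>

text \<open>\<open>GF4 a b\<close> stands for \<open>a \<mu> + b\<close>, where \<open>\<mu>\<^sup>2 = \<mu> + 1\<close>.\<close>

datatype gf4 = GF4 bit bit

instantiation gf4 :: field
begin

definition zero_gf4 :: gf4 where "0 = GF4 0 0"
definition one_gf4 :: gf4 where "1 = GF4 0 1"

primrec plus_gf4 :: "gf4 \<Rightarrow> gf4 \<Rightarrow> gf4" where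
  "GF4 a b + y = (case y of GF4 c d \<Rightarrow> GF4 (a + c) (b + d))"

primrec times_gf4 :: "gf4 \<Rightarrow> gf4 \<Rightarrow> gf4" where
  "GF4 a b * y = (case y of GF4 c d \<Rightarrow> GF4 (a * d + b * c + a * c) (b * d + a * c))"

definition uminus_gf4 :: "gf4 \<Rightarrow> gf4" where "- x = (x :: gf4)"
definition minus_gf4 :: "gf4 \<Rightarrow> gf4 \<Rightarrow> gf4" where "x - y = x + (y :: gf4)"

text \<open>Nonzero elements satisfy \<open>x\<^sup>3 = 1\<close>.\<close>

definition inverse_gf4 :: "gf4 \<Rightarrow> gf4" where "inverse x = x * (x :: gf4)"
definition divide_gf4 :: "gf4 \<Rightarrow> gf4 \<Rightarrow> gf4" where "x div y = x * inverse (y :: gf4)"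

instance
proof
  fix x y z :: gf4
  obtain a b where x: "x = GF4 a b" by (cases x)
  obtain c d where y: "y = GF4 c d" by (cases y)
  obtain e f where z: "z = GF4 e f" by (cases z)
  note defs = zero_gf4_def one_gf4_def uminus_gf4_def minus_gf4_def inverse_gf4_def divide_gf4_def
  show "x * y * z = x * (y * z)"
    unfolding x y z by (cases a; cases b; cases c; cases d; cases e; cases f) simp_all
  show "(x + y) * z = x * z + y * z"
    unfolding x y z by (cases a; cases b; cases c; cases d; cases e; cases f) simp_all
  show "x + y + z = x + (y + z)"
    unfolding x y z by (cases a; cases b; cases c; cases d; cases e; cases f) simp_all
  show "x * y = y * x"
    unfolding x y by (cases a; cases b; cases c; cases d) simp_all
  show "x + y = y + x"
    unfolding x y by (cases a; cases b; cases c; cases d) simp_all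
  show "1 * x = x" "0 + x = x" "- x + x = 0"
    unfolding x by (cases a; cases b; simp add: defs)+
  show "x - y = x + - y" "x div y = x * inverse y"
    by (simp_all add: defs)
  show "x \<noteq> 0 \<Longrightarrow> inverse x * x = 1"
    unfolding x by (cases a; cases b) (simp_all add: defs)
  show "(0 :: gf4) \<noteq> 1" "inverse (0 :: gf4) = 0"
    by (simp_all add: defs)
qed

end

instantiation gf4 ::
  "{unique_euclidean_ring, normalization_euclidean_semiring, normalization_semidom_multiplicative}"
begin

definition [simp]: "normalize_gf4 = (normalize_field :: gf4 \<Rightarrow> _)"
definition [simp]: "unit_factor_gf4 = (unit_factor_field :: gf4 \<Rightarrow> _)"
definition [simp]: "modulo_gf4 = (mod_field :: gf4 \<Rightarrow> _)"
definition [simp]: "euclidean_size_gf4 = (euclidean_size_field :: gf4 \<Rightarrow> _)"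
definition [simp]: "division_segment (x :: gf4) = 1"

instance
  by standard (simp_all add: dvd_field_iff field_split_simps split: if_splits)

end

instantiation gf4 :: euclidean_ring_gcd
begin

definition gcd_gf4 :: "gf4 \<Rightarrow> gf4 \<Rightarrow> gf4" where
  "gcd_gf4 = Euclidean_Algorithm.gcd"
definition lcm_gf4 :: "gf4 \<Rightarrow> gf4 \<Rightarrow> gf4" where
  "lcm_gf4 = Euclidean_Algorithm.lcm"
definition Gcd_gf4 :: "gf4 set \<Rightarrow> gf4" where
  "Gcd_gf4 = Euclidean_Algorithm.Gcd"
definition Lcm_gf4 :: "gf4 set \<Rightarrow> gf4" where
  "Lcm_gf4 = Euclidean_Algorithm.Lcm"

instance by standard (simp_all add: gcd_gf4_def lcm_gf4_def Gcd_gf4_def Lcm_gf4_def)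

end

instance gf4 :: field_gcd ..

definition gf4_mu :: gf4 ("\<mu>") where "\<mu> = GF4 1 0"

definition gf4_of_bit :: "bit \<Rightarrow> gf4" where "gf4_of_bit b = GF4 0 b"

lemma gf4_mu_root: "\<mu>\<^sup>2 + \<mu> + 1 = 0"
  by (simp add: gf4_mu_def power2_eq_square one_gf4_def zero_gf4_def)

lemma gf4_of_bit_hom:
  "gf4_of_bit 0 = 0" "gf4_of_bit 1 = 1"
  "gf4_of_bit (a + b) = gf4_of_bit a + gf4_of_bit b"
  "gf4_of_bit (a * b) = gf4_of_bit a * gf4_of_bit b"
  by (simp_all add: gf4_of_bit_def zero_gf4_def one_gf4_def)

lemma GF4_eq: "GF4 a b = gf4_of_bit a * \<mu> + gf4_of_bit b"
  by (cases a; cases b) (simp_all add: gf4_of_bit_def gf4_mu_def)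


section \<open>Periodic sequences\<close>

definition has_period :: "nat \<Rightarrow> (nat \<Rightarrow> 'a) \<Rightarrow> bool" where
  "has_period N v \<longleftrightarrow> 0 < N \<and> (\<forall>t. v (t + N) = v t)"

definition seq_poly :: "nat \<Rightarrow> (nat \<Rightarrow> 'a::field_gcd) \<Rightarrow> 'a poly" where
  "seq_poly N v = (\<Sum>t<N. monom (v t) t)"

definition min_poly :: "nat \<Rightarrow> (nat \<Rightarrow> 'a::field_gcd) \<Rightarrow> 'a poly" where
  "min_poly N v = (monom 1 N - 1) div gcd (monom 1 N - 1) (seq_poly N v)"

definition left_shift :: "nat \<Rightarrow> nat \<Rightarrow> (nat \<Rightarrow> 'a) \<Rightarrow> nat \<Rightarrow> 'a" where
  "left_shift N \<tau> v = (\<lambda>t. v ((t + \<tau>) mod N))"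

definition complement_seq :: "(nat \<Rightarrow> bit) \<Rightarrow> nat \<Rightarrow> bit" where
  "complement_seq v = (\<lambda>t. 1 - v t)"


section \<open>The Gray map\<close>

text \<open>The numeral type \<open>4\<close> is the ring of integers modulo 4.\<close>

definition gray :: "4 \<Rightarrow> bit \<times> bit" where
  "gray u = (if u = 0 then (0, 0) else if u = 1 then (0, 1) else if u = 2 then (1, 1) else (1, 0))"

lemma bij_gray: "bij gray"
proof -
  have "surj gray"
  proof (rule surjI)
    fix p :: "bit \<times> bit"
    show "gray (if p = (0, 0) then 0 else if p = (0, 1) then 1 else if p = (1, 1) then 2 else 3) = p"
      by (cases p; cases "fst p"; cases "snd p") (simp_all add: gray_def)
  qed
  moreover have "card (UNIV :: (bit \<times> bit) set) = 4"
  proof -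
    have "(UNIV :: bit set) = {0, 1}"
      using bit.exhaust by blast
    moreover have "card {0, 1 :: bit} = 2"
      by (simp add: card_2_iff)
    ultimately have "card (UNIV :: bit set) = 2" by (simp only:)
    then show ?thesis
      by (simp add: card_cartesian_product flip: UNIV_Times_UNIV)
  qed
  ultimately have "inj gray"
    by (intro eq_card_imp_inj_on) simp_all
  with \<open>surj gray\<close> show ?thesis by (rule bijI[rotated])
qed

definition gray_inv_seq :: "(nat \<Rightarrow> bit) \<Rightarrow> (nat \<Rightarrow> bit) \<Rightarrow> nat \<Rightarrow> 4" where
  "gray_inv_seq v w = (\<lambda>t. inv gray (v t, w t))"

text \<open>The identification of quaternary symbols with elements of the field with four elements.\<close>

definition gf4_of_quat :: "4 \<Rightarrow> gf4" where
  "gf4_of_quat u = (case gray u of (a, b) \<Rightarrow> gf4_of_bit a * \<mu> + gf4_of_bit b)"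

lemma gf4_of_gray_inv_seq:
  "gf4_of_quat (gray_inv_seq v w t) = gf4_of_bit (v t) * \<mu> + gf4_of_bit (w t)"
  by (simp add: gf4_of_quat_def gray_inv_seq_def surj_f_inv_f bij_is_surj[OF bij_gray])

end

theory Submission
  imports Defs
begin

text \<open>
  Let \<open>S\<close> be the sequence polynomial of \<open>s\<close>, \<open>M = x\<^sup>N - 1\<close>, \<open>G = gcd M S\<close>, \<open>M = G P\<close>, \<open>S = G T\<close>, and
  \<open>h = N / 2\<close>. Modulo \<open>M\<close>, shifting by \<open>h\<close> is multiplication by \<open>x\<^sup>h\<close>, so the sequence polynomial
  of \<open>u\<close> is congruent to \<open>C S\<close> in case (i) and to \<open>C S + M / (x - 1)\<close> in case (ii), where
  \<open>C = \<mu> + x\<^sup>h\<close>. As \<open>C\<close> differs from both \<open>x\<^sup>h - 1\<close> and \<open>x\<^sup>h + 1\<close> by a nonzero constant, it is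
  coprime to \<open>M\<close>. In case (ii), \<open>M / (x - 1) = G Q\<close> with \<open>P = (x - 1) Q\<close>; since \<open>(x - 1)\<^sup>2\<close> divides
  \<open>P\<close>, every prime factor of \<open>P\<close> divides \<open>Q\<close>. Hence the gcd with \<open>M\<close> is \<open>G\<close> in both cases.
\<close>

abbreviation lift_poly :: "bit poly \<Rightarrow> gf4 poly" where
  "lift_poly \<equiv> map_poly gf4_of_bit"

lemma coeff_lift_poly [simp]: "coeff (lift_poly p) n = gf4_of_bit (coeff p n)"
  by (simp add: coeff_map_poly gf4_of_bit_hom)

lemma lift_poly_0 [simp]: "lift_poly 0 = 0"
  by (simp add: poly_eq_iff gf4_of_bit_hom)

lemma lift_poly_1 [simp]: "lift_poly 1 = 1"
  by (simp add: poly_eq_iff coeff_1 gf4_of_bit_hom)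

lemma lift_poly_add: "lift_poly (p + q) = lift_poly p + lift_poly q"
  by (simp only: poly_eq_iff coeff_lift_poly coeff_add gf4_of_bit_hom(3) simp_thms)

lemma lift_poly_diff: "lift_poly (p - q) = lift_poly p - lift_poly q"
  using lift_poly_add[of "p - q" q] by (simp add: algebra_simps)

lemma lift_poly_monom: "lift_poly (monom c n) = monom (gf4_of_bit c) n"
  by (simp add: map_poly_monom gf4_of_bit_hom)

lemma lift_poly_sum: "lift_poly (sum f A) = (\<Sum>x\<in>A. lift_poly (f x))"
  by (induction A rule: infinite_finite_induct) (simp_all add: lift_poly_add)

lemma lift_poly_mult: "lift_poly (p * q) = lift_poly p * lift_poly q"
proof -
  have sum: "gf4_of_bit (sum f A) = (\<Sum>x\<in>A. gf4_of_bit (f x))" for f :: "nat \<Rightarrow> bit" and A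
    by (induction A rule: infinite_finite_induct)
       (simp_all add: gf4_of_bit_hom del: add_bit_eq_xor)
  show ?thesis
    by (simp add: poly_eq_iff coeff_mult sum gf4_of_bit_hom del: mult_bit_eq_and)
qed

lemma degree_lift_poly [simp]: "degree (lift_poly p) = degree p"
  by (rule degree_map_poly) (simp add: gf4_of_bit_def zero_gf4_def)

lemma normalize_monic:
  fixes p :: "'a :: field_gcd poly"
  assumes "lead_coeff p = 1"
  shows "normalize p = p"
  using assms by (simp add: normalize_poly_eq_map_poly)

lemma lift_seq_poly: "lift_poly (seq_poly N v) = seq_poly N (\<lambda>t. gf4_of_bit (v t))"
  by (simp add: seq_poly_def lift_poly_sum lift_poly_monom)

text \<open>A Bezout identity over F_2 remains one over F_4, so extending the field creates no new
  common factors.\<close>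

lemma coprime_lift_poly:
  assumes "coprime p q"
  shows "coprime (lift_poly p) (lift_poly q)"
proof -
  obtain a b where "a * p + b * q = 1"
    using assms by (metis bezout_coefficients_fst_snd coprime_imp_gcd_eq_1)
  then have eq: "lift_poly a * lift_poly p + lift_poly b * lift_poly q = 1"
    by (metis lift_poly_add lift_poly_mult lift_poly_1)
  show ?thesis
  proof (rule coprimeI)
    fix d assume "d dvd lift_poly p" "d dvd lift_poly q"
    then show "is_unit d"
      unfolding eq[symmetric] by simp
  qed
qed

lemma seq_poly_add: "seq_poly N (\<lambda>t. v t + w t) = seq_poly N v + seq_poly N w"
  by (simp add: seq_poly_def sum.distrib flip: add_monom)

lemma seq_poly_smult: "seq_poly N (\<lambda>t. c * v t) = smult c (seq_poly N v)"
  unfolding seq_poly_def by (induction N) (simp_all add: smult_add_right smult_monom)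

text \<open>Geometric sum. It identifies the polynomial of the all-one sequence as
  \<open>M / (x - 1)\<close>, the term that complementing contributes.\<close>

lemma seq_poly_one: "[:-1, 1:] * seq_poly N (\<lambda>_. 1) = monom 1 N - 1"
proof -
  have "[:-1, 1:] = (monom 1 1 - 1 :: 'a poly)"
    by (simp add: monom_altdef one_pCons)
  then show ?thesis
    using power_diff_1_eq[of "monom 1 1 :: 'a poly" N]
    by (simp add: seq_poly_def monom_power)
qed

lemma seq_poly_split:
  "seq_poly (h + h) v = seq_poly h v + monom 1 h * seq_poly h (\<lambda>t. v (t + h))"
proof -
  have "(\<Sum>t<h + h. monom (v t) t)
      = (\<Sum>t<h. monom (v t) t) + (\<Sum>t\<in>{h..<h + h}. monom (v t) t)"
    by (simp add: sum.atLeastLessThan_concat lessThan_atLeast0)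
  also have "(\<Sum>t\<in>{h..<h + h}. monom (v t) t) = (\<Sum>t<h. monom (v (t + h)) (t + h))"
    using sum.shift_bounds_nat_ivl[of "\<lambda>t. monom (v t) t" 0 h h]
    by (simp add: lessThan_atLeast0)
  finally show ?thesis
    by (simp add: seq_poly_def sum_distrib_left mult_monom add.commute)
qed

text \<open>The shift by half a period swaps the two halves of the sequence:
  \<open>A + x^h B\<close> becomes \<open>B + x^h A\<close>. Subtracting
  \<open>x^h (A + x^h B)\<close> leaves \<open>B - x^(2h) B\<close>.\<close>

lemma seq_poly_half_shift:
  "(monom 1 (h + h) - 1) dvd
     (seq_poly (h + h) (left_shift (h + h) h v) - monom 1 h * seq_poly (h + h) v)"
proof -
  let ?A = "seq_poly h v" and ?B = "seq_poly h (\<lambda>t. v (t + h))"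
  have "(t + h) mod (h + h) = t + h" "(t + h + h) mod (h + h) = t" if "t < h" for t
    using that mod_add_self2[of t "h + h"] by (simp_all add: add.assoc)
  then have "seq_poly h (left_shift (h + h) h v) = ?B"
    and "seq_poly h (\<lambda>t. left_shift (h + h) h v (t + h)) = ?A"
    by (simp_all add: seq_poly_def left_shift_def)
  then have "seq_poly (h + h) (left_shift (h + h) h v) - monom 1 h * seq_poly (h + h) v
           = (monom 1 (h + h) - 1) * - ?B"
    by (simp add: seq_poly_split algebra_simps mult_monom
          flip: mult.assoc)
  then show ?thesis by simp
qed

lemma coprime_mu_plus_monom:
  "coprime (monom 1 (h + h) - 1) ([:\<mu>:] + monom 1 h)"
proof -
  let ?X = "monom 1 h :: gf4 poly"
  \<comment> \<open>Both constants are nonzero because \<mu> lies outside F_2.\<close>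
  have unit: "is_unit ([:\<mu> + 1:] :: gf4 poly)" "is_unit ([:\<mu> - 1:] :: gf4 poly)"
    by (simp_all add: is_unit_const_poly_iff dvd_field_iff gf4_mu_def one_gf4_def zero_gf4_def
        minus_gf4_def)
  have "coprime (?X - 1) ([:\<mu>:] + ?X)"
  proof (rule coprimeI)
    fix d assume "d dvd ?X - 1" "d dvd [:\<mu>:] + ?X"
    then have "d dvd ([:\<mu>:] + ?X) - (?X - 1)" by (rule dvd_diff[rotated])
    also have "\<dots> = [:\<mu> + 1:]" by (simp add: one_pCons)
    finally show "is_unit d" using unit(1) by (rule dvd_unit_imp_unit)
  qed
  moreover have "coprime (?X + 1) ([:\<mu>:] + ?X)"
  proof (rule coprimeI)
    fix d assume "d dvd ?X + 1" "d dvd [:\<mu>:] + ?X"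
    then have "d dvd ([:\<mu>:] + ?X) - (?X + 1)" by (rule dvd_diff[rotated])
    also have "\<dots> = [:\<mu> - 1:]" by (simp add: one_pCons)
    finally show "is_unit d" using unit(2) by (rule dvd_unit_imp_unit)
  qed
  moreover have "monom 1 (h + h) - 1 = (?X - 1) * (?X + 1)"
    by (simp add: algebra_simps mult_monom)
  ultimately show ?thesis by simp
qed

text \<open>The condition \<open>p dvd q\<^sup>2\<close> makes every prime factor of
  \<open>p\<close> divide \<open>q\<close> without any factorization being mentioned. A common
  divisor of \<open>p\<close> and \<open>a + q\<close> divides
  \<open>(a + q) * (a - q) + q\<^sup>2\<close>, which is \<open>a\<^sup>2\<close>, and that is
  coprime to \<open>p\<close>.\<close>

lemma coprime_add_of_dvd_square:
  fixes p a q :: "'a :: ring_gcd"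
  assumes "coprime p a" and "p dvd q\<^sup>2"
  shows "coprime p (a + q)"
proof (rule coprimeI)
  fix d assume d: "d dvd p" "d dvd a + q"
  have "d dvd (a + q) * (a - q) + q\<^sup>2"
    using d assms(2) by (meson dvd_add dvd_mult2 dvd_trans)
  also have "\<dots> = a\<^sup>2"
    by (simp add: power2_eq_square algebra_simps)
  finally show "is_unit d"
    using assms(1) d(1) by (meson coprime_common_divisor coprime_power_right_iff)
qed

text \<open>Coprimality fixes the gcd as \<open>g\<close> up to a unit; since polynomial gcds are
  normalized, a monic \<open>g\<close> is the gcd itself.\<close>

lemma div_gcd_eq:
  fixes g p t :: "'a :: field_gcd poly"
  assumes "coprime p t" and "lead_coeff g = 1"
  shows "(g * p) div gcd (g * p) (g * t) = p"
proof -
  have "g \<noteq> 0" using assms(2) by auto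
  moreover have "gcd (g * p) (g * t) = g"
    using assms by (simp add: gcd_mult_left normalize_monic)
  ultimately show ?thesis by simp
qed

text \<open>Both parts are instances: \<open>r = 0\<close> in (i) and \<open>r = M / (x - 1)\<close> in (ii).\<close>

lemma min_poly_lift:
  fixes s :: "nat \<Rightarrow> bit" and N h :: nat
  defines "M \<equiv> monom 1 N - 1"
  assumes "N = h + h" and "0 < N"
    and U: "seq_poly N U = smult \<mu> (lift_poly (seq_poly N s))
              + lift_poly (seq_poly N (left_shift N h s)) + r"
    and r: "r = lift_poly (gcd M (seq_poly N s)) * q"
    and q: "lift_poly (min_poly N s) dvd q\<^sup>2"
  shows "min_poly N U = lift_poly (min_poly N s)"
proof -
  define S where "S = seq_poly N s"
  define G where "G = gcd M S"
  define P where "P = min_poly N s"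
  define T where "T = S div G"
  define C where "C = [:\<mu>:] + monom 1 h"
  have "M \<noteq> 0"
  proof
    assume "M = 0"
    then have "coeff M N = 0" by simp
    with \<open>0 < N\<close> show False by (simp add: M_def coeff_1)
  qed
  have P_eq: "P = M div G"
    by (simp add: P_def min_poly_def G_def S_def M_def)
  have MGP: "M = G * P" and SGT: "S = G * T"
    by (simp_all add: P_eq T_def G_def)
  have "coprime P T"
    using \<open>M \<noteq> 0\<close> unfolding P_eq T_def G_def by (intro div_gcd_coprime) simp
  then have PT: "coprime (lift_poly P) (lift_poly T)"
    by (rule coprime_lift_poly)
  have "G \<noteq> 0" using \<open>M \<noteq> 0\<close> by (simp add: G_def)
  \<comment> \<open>The only nonzero element of F_2 is 1, so the nonzero \<open>G\<close> is
    monic.\<close>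
  then have monic: "lead_coeff (lift_poly G) = 1"
    by (cases "lead_coeff G") (simp_all add: gf4_of_bit_hom)
  have lM: "lift_poly M = monom 1 N - 1"
    by (simp add: M_def lift_poly_diff lift_poly_monom gf4_of_bit_hom)
  have "coprime (lift_poly M) C"
    unfolding lM C_def \<open>N = h + h\<close> by (rule coprime_mu_plus_monom)
  then have PC: "coprime (lift_poly P) C"
    by (simp add: MGP lift_poly_mult)
  have "M dvd seq_poly N (left_shift N h s) - monom 1 h * S"
    unfolding M_def S_def \<open>N = h + h\<close> by (rule seq_poly_half_shift)
  then obtain W where "seq_poly N (left_shift N h s) - monom 1 h * S = M * W"
    by (rule dvdE)
  then have "seq_poly N (left_shift N h s) = monom 1 h * S + M * W"
    by (simp add: algebra_simps)
  then have "seq_poly N U = smult \<mu> (lift_poly S) + (monom 1 h * lift_poly S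
               + lift_poly M * lift_poly W) + lift_poly G * q"
    by (simp add: U r S_def G_def lift_poly_add lift_poly_mult lift_poly_monom gf4_of_bit_hom)
  also have "\<dots> = lift_poly G * (C * lift_poly T + lift_poly P * lift_poly W + q)"
    by (simp add: MGP SGT C_def lift_poly_mult algebra_simps)
  finally have U_eq: "seq_poly N U = lift_poly G * (C * lift_poly T + lift_poly P * lift_poly W + q)" .
  \<comment> \<open>Modulo \<open>P\<close> the second argument is \<open>C * T\<close>, a product
    of two factors coprime to \<open>P\<close>.\<close>
  have "coprime (lift_poly P) (C * lift_poly T + lift_poly P * lift_poly W)"
    using PT PC by (metis coprime_iff_gcd_eq_1 coprime_mult_right_iff gcd_add_mult add.commute mult.commute)
  then have "coprime (lift_poly P) (C * lift_poly T + lift_poly P * lift_poly W + q)"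
    by (rule coprime_add_of_dvd_square) (use q in \<open>simp add: P_def\<close>)
  then have "lift_poly G * lift_poly P div gcd (lift_poly G * lift_poly P) (seq_poly N U) = lift_poly P"
    unfolding U_eq by (rule div_gcd_eq) (rule monic)
  moreover have "lift_poly G * lift_poly P = monom 1 N - 1"
    by (metis lM MGP lift_poly_mult)
  ultimately show ?thesis
    by (simp only: min_poly_def[of N U] P_def)
qed

theorem theorem6:
  fixes s :: "nat \<Rightarrow> bit" and N :: nat
  assumes "has_period N s" and "even N"
  shows "(\<forall>u. u = gray_inv_seq s (left_shift N (N div 2) s) \<longrightarrow>
            min_poly N (\<lambda>t. gf4_of_quat (u t)) = map_poly gf4_of_bit (min_poly N s))
       \<and> (\<forall>u. u = gray_inv_seq s (left_shift N (N div 2) (complement_seq s)) \<and>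
            [:-1, 1:]\<^sup>2 dvd min_poly N s \<longrightarrow>
            min_poly N (\<lambda>t. gf4_of_quat (u t)) = map_poly gf4_of_bit (min_poly N s))"
proof -
  define h where "h = N div 2"
  have N: "N = h + h" "0 < N"
    using assms by (auto simp: h_def has_period_def)
  let ?s' = "left_shift N h s"
  have seq: "seq_poly N (\<lambda>t. gf4_of_bit (s t) * \<mu> + gf4_of_bit (?s' t))
     = smult \<mu> (lift_poly (seq_poly N s)) + lift_poly (seq_poly N ?s')"
    by (simp add: seq_poly_add seq_poly_smult lift_seq_poly mult.commute[of _ \<mu>])
  have "min_poly N (\<lambda>t. gf4_of_quat (gray_inv_seq s ?s' t)) = lift_poly (min_poly N s)"
    by (rule min_poly_lift[OF N, where r = 0 and q = 0])
       (simp_all add: gf4_of_gray_inv_seq seq)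
  moreover have "min_poly N (\<lambda>t. gf4_of_quat (gray_inv_seq s (left_shift N h (complement_seq s)) t))
      = lift_poly (min_poly N s)" if dvd: "[:-1, 1:]\<^sup>2 dvd min_poly N s"
  proof -
    define J where "J = seq_poly N (\<lambda>_. 1 :: bit)"
    define G where "G = gcd (monom 1 N - 1) (seq_poly N s)"
    obtain K where K: "min_poly N s = [:-1, 1:]\<^sup>2 * K"
      using dvd by (rule dvdE)
    \<comment> \<open>One factor \<open>x - 1\<close> fewer than in \<open>P\<close>, so that
      \<open>Q\<^sup>2 = P * K\<close>.\<close>
    define Q where "Q = [:-1, 1:] * K"
    have P: "min_poly N s = [:-1, 1:] * Q"
      by (simp only: K Q_def power2_eq_square mult.assoc)
    \<comment> \<open>\<open>M\<close> is computed in two ways; cancelling \<open>x - 1\<close>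
      shows that \<open>G\<close> divides \<open>J\<close>, with cofactor \<open>Q\<close>.\<close>
    have "[:-1, 1:] * J = monom 1 N - 1"
      unfolding J_def by (rule seq_poly_one)
    also have "\<dots> = G * min_poly N s"
      by (simp add: min_poly_def G_def)
    also have "\<dots> = [:-1, 1:] * (G * Q)"
      by (simp only: P mult.left_commute)
    finally have J: "J = G * Q"
      by (subst (asm) mult_left_cancel) simp_all
    have "min_poly N s dvd Q\<^sup>2"
      by (auto simp: K Q_def power_mult_distrib power2_eq_square[of K] simp del: mult_pCons_left)
    then have "lift_poly (min_poly N s) dvd (lift_poly Q)\<^sup>2"
      by (metis dvd_def lift_poly_mult power2_eq_square)
    \<comment> \<open>In characteristic 2, complementing adds the constant sequence 1, which the
      shift leaves unchanged.\<close>
    moreover have "gf4_of_bit (left_shift N h (complement_seq s) t) = gf4_of_bit (?s' t) + 1" for t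
      by (cases "s ((t + h) mod N)")
         (simp_all add: left_shift_def complement_seq_def gf4_of_bit_def one_gf4_def)
    then have "seq_poly N (\<lambda>t. gf4_of_quat (gray_inv_seq s (left_shift N h (complement_seq s)) t))
       = seq_poly N (\<lambda>t. (gf4_of_bit (s t) * \<mu> + gf4_of_bit (?s' t)) + 1)"
      by (simp add: gf4_of_gray_inv_seq add.assoc)
    then have "seq_poly N (\<lambda>t. gf4_of_quat (gray_inv_seq s (left_shift N h (complement_seq s)) t))
       = smult \<mu> (lift_poly (seq_poly N s)) + lift_poly (seq_poly N ?s') + lift_poly J"
      by (simp only: seq_poly_add[of N _ "\<lambda>_. 1"] seq J_def lift_seq_poly[of N "\<lambda>_. 1"] gf4_of_bit_hom)
    ultimately show ?thesis
      by (intro min_poly_lift[OF N, where r = "lift_poly J" and q = "lift_poly Q"])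
         (simp_all add: J G_def lift_poly_mult)
  qed
  ultimately show ?thesis
    by (simp add: h_def)
qed

end
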